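(* The Kakutani-Fibonacci transformation $T:[0,1[\to[0,1[$ is uniquely ergodic.
   Context: $[a,b[$ denotes the half-open interval $\{x:a\le x<b\}$. Let $\alpha=\frac{\sqrt5-1}{2}$, so $\alpha+\alpha^2=1$. The Kakutani-Fibonacci transformation $T:[0,1[\to[0,1[$ is defined piecewise by: $T(x)=x+\alpha$ for $x\in I_1=[0,\alpha^2[$; and, for every $k\ge1$, $T(x)=x+\alpha^{2k}-\sum_{j=0}^{k-1}\alpha^{2j+1}$ for $x\in I_{2k}=\big[\sum_{j=0}^{k-1}\alpha^{2j+1},\sum_{j=0}^{k}\alpha^{2j+1}\big[$, and $T(x)=x+\alpha^{2k+1}-\sum_{j=0}^{k-1}\alpha^{2(j+1)}$ for $x\in I_{2k+1}=\big[\sum_{j=0}^{k-1}\alpha^{2(j+1)},\sum_{j=0}^{k}\alpha^{2(j+1)}\big[$. The intervals $I_k$, $k\ge1$, partition $[0,1[$. Uniquely ergodic means that there is exactly one $T$-invariant Borel probability measure on $[0,1[$. *)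

theory Defs
  imports "HOL-Probability.Probability"
begin

definition golden :: real ("\<alpha>") where
  "\<alpha> = (sqrt 5 - 1) / 2"

(* For n = 1 the sum is empty and the left endpoint is 0.  The index n = 0 is never used. *)
definition kf_left :: "nat \<Rightarrow> real" where
  "kf_left n = (if even n then (\<Sum>j<n div 2. \<alpha> ^ (2 * j + 1))
                else (\<Sum>j<n div 2. \<alpha> ^ (2 * (j + 1))))"

definition kf_interval :: "nat \<Rightarrow> real set" where
  "kf_interval n = {kf_left n ..< kf_left (n + 2)}"

(* The three cases of the usual piecewise definition have the common form
   x + \<alpha> ^ n - kf_left n on the n-th interval; they are derived in their usual form below.
   Since the intervals with n \<ge> 1 partition {0..<1} (kf_interval_partition), the index chosen
   by THE is well defined there.  Values outside {0..<1} are irrelevant. *)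
definition kakutani_fibonacci :: "real \<Rightarrow> real" where
  "kakutani_fibonacci x =
     (let n = (THE n. n \<ge> 1 \<and> x \<in> kf_interval n) in x + \<alpha> ^ n - kf_left n)"

definition invariant_prob :: "'a measure \<Rightarrow> ('a \<Rightarrow> 'a) \<Rightarrow> 'a measure \<Rightarrow> bool" where
  "invariant_prob M T \<mu> \<longleftrightarrow> sets \<mu> = sets M \<and> prob_space \<mu> \<and>
     (\<forall>A \<in> sets M. emeasure \<mu> (T -` A \<inter> space M) = emeasure \<mu> A)"

(* Only the measurable structure of M matters.  Measurability also says that T maps
   space M into itself. *)
definition uniquely_ergodic :: "'a measure \<Rightarrow> ('a \<Rightarrow> 'a) \<Rightarrow> bool" where
  "uniquely_ergodic M T \<longleftrightarrow> T \<in> M \<rightarrow>\<^sub>M M \<and> (\<exists>!\<mu>. invariant_prob M T \<mu>)"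

lemma golden_pos: "0 < \<alpha>"
  by (simp add: golden_def)

lemma golden_less_1: "\<alpha> < 1"
proof -
  have "sqrt 5 < 3" by (rule real_less_lsqrt) auto
  then show ?thesis by (simp add: golden_def)
qed

lemma golden_square: "\<alpha> * \<alpha> = 1 - \<alpha>"
  by (simp add: golden_def field_simps)

lemma kf_left_even: "kf_left (2 * k) = 1 - \<alpha> ^ (2 * k)"
proof -
  have "(\<Sum>j<k. \<alpha> ^ (2 * j + 1)) = 1 - \<alpha> ^ (2 * k)"
  proof (induction k)
    case (Suc k)
    have "\<alpha> ^ (2 * Suc k) = \<alpha> ^ (2 * k) * (\<alpha> * \<alpha>)" by simp
    then have "\<alpha> ^ (2 * Suc k) = \<alpha> ^ (2 * k) - \<alpha> ^ (2 * k + 1)"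
      unfolding golden_square by (simp add: algebra_simps)
    then show ?case using Suc by simp
  qed simp
  then show ?thesis by (simp add: kf_left_def)
qed

lemma kf_left_odd: "kf_left (2 * k + 1) = \<alpha> - \<alpha> ^ (2 * k + 1)"
proof -
  have "(\<Sum>j<k. \<alpha> ^ (2 * (j + 1))) = \<alpha> - \<alpha> ^ (2 * k + 1)"
  proof (induction k)
    case (Suc k)
    have "\<alpha> ^ (2 * Suc k + 1) = \<alpha> ^ (2 * k + 1) * (\<alpha> * \<alpha>)" by simp
    then have "\<alpha> ^ (2 * Suc k + 1) = \<alpha> ^ (2 * k + 1) - \<alpha> ^ (2 * (k + 1))"
      unfolding golden_square by (simp add: algebra_simps)
    then show ?case using Suc by simp
  qed simp
  then show ?thesis by (simp add: kf_left_def)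
qed

lemma kf_interval_even:
  "kf_interval (2 * k) = {1 - \<alpha> ^ (2 * k) ..< 1 - \<alpha> ^ (2 * (k + 1))}"
  using kf_left_even[of k] kf_left_even[of "k + 1"] by (simp add: kf_interval_def)

lemma kf_interval_odd:
  "kf_interval (2 * k + 1) = {\<alpha> - \<alpha> ^ (2 * k + 1) ..< \<alpha> - \<alpha> ^ (2 * (k + 1) + 1)}"
  using kf_left_odd[of k] kf_left_odd[of "k + 1"] by (simp add: kf_interval_def)

lemma golden_power_mono: "m \<le> n \<Longrightarrow> \<alpha> ^ n \<le> \<alpha> ^ m"
  using golden_pos golden_less_1 by (simp add: power_decreasing)

lemma kf_interval_unique:
  assumes "m \<ge> 1" "n \<ge> 1" "x \<in> kf_interval m" "x \<in> kf_interval n"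
  shows "m = n"
proof -
  have ev: "\<alpha> \<le> x" if "x \<in> kf_interval n" "n \<ge> 1" "even n" for n
  proof -
    from that obtain k where k: "n = 2 * k" by (auto elim: evenE)
    have "\<alpha> ^ (2 * k) \<le> \<alpha> ^ 2" using that k by (intro golden_power_mono) auto
    moreover have "1 - \<alpha> ^ (2 * k) \<le> x" using that k by (simp add: kf_interval_even)
    ultimately show ?thesis using golden_square by (simp add: power2_eq_square)
  qed
  have od: "x < \<alpha>" if "x \<in> kf_interval n" "odd n" for n
  proof -
    from that obtain k where k: "n = 2 * k + 1" by (auto elim: oddE)
    have "x < \<alpha> - \<alpha> ^ (2 * (k + 1) + 1)" using that unfolding k kf_interval_odd by simp
    moreover have "0 < \<alpha> ^ (2 * (k + 1) + 1)" using golden_pos by simp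
    ultimately show ?thesis by linarith
  qed
  have less: "\<alpha> ^ n < \<alpha> ^ m \<Longrightarrow> m < n" for m n
    using golden_power_mono[of n m] by linarith
  have ee: False if eq: "x \<in> kf_interval (2 * k)" "x \<in> kf_interval (2 * l)" "k < l" for k l
  proof -
    have "\<alpha> ^ (2 * (k + 1)) < \<alpha> ^ (2 * l)" using eq(1,2) unfolding kf_interval_even by simp
    from less[OF this] \<open>k < l\<close> show False by simp
  qed
  have oo: False if eq: "x \<in> kf_interval (2 * k + 1)" "x \<in> kf_interval (2 * l + 1)" "k < l" for k l
  proof -
    have "\<alpha> ^ (2 * (k + 1) + 1) < \<alpha> ^ (2 * l + 1)"
      using eq(1,2) unfolding kf_interval_odd by simp
    from less[OF this] \<open>k < l\<close> show False by simp
  qed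
  show ?thesis
  proof (cases "even m")
    case True
    then have "even n" using ev[OF assms(3,1)] od[OF assms(4)] by force
    with True obtain k l where "m = 2 * k" "n = 2 * l" by (auto elim!: evenE)
    then show ?thesis using ee[of k l] ee[of l k] assms(3,4) by (cases k l rule: linorder_cases) auto
  next
    case False
    then have "odd n" using od[OF assms(3)] ev[OF assms(4,2)] by force
    with False obtain k l where "m = 2 * k + 1" "n = 2 * l + 1" by (auto elim!: oddE)
    then show ?thesis using oo[of k l] oo[of l k] assms(3,4) by (cases k l rule: linorder_cases) auto
  qed
qed

lemma kf_interval_partition:
  "(\<Union>n\<in>{1..}. kf_interval n) = {0..<1}" "disjoint_family_on kf_interval {1..}"
proof -
  show "disjoint_family_on kf_interval {1..}"
    using kf_interval_unique by (fastforce simp: disjoint_family_on_def)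
  show "(\<Union>n\<in>{1..}. kf_interval n) = {0..<1}"
  proof (intro equalityI subsetI)
    fix x assume "x \<in> (\<Union>n\<in>{1..}. kf_interval n)"
    then obtain n where n: "n \<ge> 1" "x \<in> kf_interval n" by auto
    show "x \<in> {0..<1}"
    proof (cases "even n")
      case True
      then obtain k where k: "n = 2 * k" by (auto elim: evenE)
      have "\<alpha> ^ (2 * k) \<le> 1" using golden_power_mono[of 0 "2 * k"] by simp
      moreover have "0 < \<alpha> ^ (2 * (k + 1))" using golden_pos by simp
      ultimately show ?thesis using n unfolding k kf_interval_even by auto
    next
      case False
      then obtain k where k: "n = 2 * k + 1" by (auto elim: oddE)
      have "\<alpha> ^ (2 * k + 1) \<le> \<alpha>" using golden_power_mono[of 1 "2 * k + 1"] by simp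
      moreover have "0 < \<alpha> ^ (2 * (k + 1) + 1)" using golden_pos by simp
      ultimately show ?thesis using n golden_less_1 unfolding k kf_interval_odd by auto
    qed
  next
    fix x :: real assume x: "x \<in> {0..<1}"
    have ex: "\<exists>N. \<alpha> ^ N < e" if "e > 0" for e :: real
      using real_arch_pow_inv[OF that golden_less_1] .
    show "x \<in> (\<Union>n\<in>{1..}. kf_interval n)"
    proof (cases "x < \<alpha>")
      case True
      define P where "P k \<longleftrightarrow> x < \<alpha> - \<alpha> ^ (2 * (k + 1) + 1)" for k
      obtain N where "\<alpha> ^ N < \<alpha> - x" using ex[of "\<alpha> - x"] True by auto
      moreover have "\<alpha> ^ (2 * (N + 1) + 1) \<le> \<alpha> ^ N" by (rule golden_power_mono) simp
      ultimately have "P N" by (simp add: P_def)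
      define k where "k = (LEAST k. P k)"
      have "P k" unfolding k_def using \<open>P N\<close> by (rule LeastI)
      moreover have "\<alpha> - \<alpha> ^ (2 * k + 1) \<le> x"
      proof (cases k)
        case (Suc l)
        then have "\<not> P l" unfolding k_def using not_less_Least[of l P] by simp
        then show ?thesis by (simp add: P_def Suc)
      qed (use x in simp)
      ultimately have "x \<in> kf_interval (2 * k + 1)" unfolding kf_interval_odd P_def by simp
      then show ?thesis by force
    next
      case False
      define P where "P k \<longleftrightarrow> x < 1 - \<alpha> ^ (2 * (k + 1))" for k
      obtain N where "\<alpha> ^ N < 1 - x" using ex[of "1 - x"] x by auto
      moreover have "\<alpha> ^ (2 * (N + 1)) \<le> \<alpha> ^ N" by (rule golden_power_mono) simp
      ultimately have "P N" by (simp add: P_def)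
      define k where "k = (LEAST k. P k)"
      have "P k" unfolding k_def using \<open>P N\<close> by (rule LeastI)
      have "k \<noteq> 0"
      proof
        assume "k = 0"
        then show False using \<open>P k\<close> False golden_square by (simp add: P_def power2_eq_square)
      qed
      then obtain l where l: "k = Suc l" by (cases k) auto
      then have "\<not> P l" unfolding k_def using not_less_Least[of l P] by simp
      then have "x \<in> kf_interval (2 * k)" using \<open>P k\<close> unfolding kf_interval_even P_def l by simp
      then show ?thesis using \<open>k \<noteq> 0\<close> by force
    qed
  qed
qed

lemma kakutani_fibonacci_eq:
  assumes "n \<ge> 1" "x \<in> kf_interval n"
  shows "kakutani_fibonacci x = x + \<alpha> ^ n - kf_left n"
proof -
  have "(THE n. n \<ge> 1 \<and> x \<in> kf_interval n) = n"
    using assms kf_interval_unique by (intro the_equality) auto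
  then show ?thesis by (simp add: kakutani_fibonacci_def)
qed

lemma kakutani_fibonacci_1:
  assumes "x \<in> {0..<\<alpha> ^ 2}"
  shows "kakutani_fibonacci x = x + \<alpha>"
  using kakutani_fibonacci_eq[of 1 x] assms by (simp add: kf_interval_def kf_left_def)

lemma kakutani_fibonacci_even:
  assumes "k \<ge> 1"
    and "x \<in> {(\<Sum>j=0..k-1. \<alpha> ^ (2 * j + 1)) ..< (\<Sum>j=0..k. \<alpha> ^ (2 * j + 1))}"
  shows "kakutani_fibonacci x = x + \<alpha> ^ (2 * k) - (\<Sum>j=0..k-1. \<alpha> ^ (2 * j + 1))"
proof -
  have s: "{0..k - 1} = {..<k}" "{0..k} = {..<k + 1}" using assms(1) by auto
  show ?thesis
    using kakutani_fibonacci_eq[of "2 * k" x] assms unfolding s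
    by (simp add: kf_interval_def kf_left_def)
qed

lemma kakutani_fibonacci_odd:
  assumes "k \<ge> 1"
    and "x \<in> {(\<Sum>j=0..k-1. \<alpha> ^ (2 * (j + 1))) ..< (\<Sum>j=0..k. \<alpha> ^ (2 * (j + 1)))}"
  shows "kakutani_fibonacci x = x + \<alpha> ^ (2 * k + 1) - (\<Sum>j=0..k-1. \<alpha> ^ (2 * (j + 1)))"
proof -
  have s: "{0..k - 1} = {..<k}" "{0..k} = {..<k + 1}" using assms(1) by auto
  show ?thesis
    using kakutani_fibonacci_eq[of "2 * k + 1" x] assms unfolding s
    by (simp add: kf_interval_def kf_left_def)
qed

end

theory Submission
  imports Defs
begin

text \<open>
  The map T is self-similar: its first return map to {0..<a}, where a is the golden number, is T
  rescaled by a. Hence if \<mu> is an invariant probability, then so is its normalized and rescaled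
  restriction \<mu>' to {0..<a}. As T translates {0..<a^2} onto {a..<1}, the measure \<mu> is recovered
  from \<mu>'. On the masses p, p' of {0..<a} this gives p = 1 / (1 + p'), a contraction, so p = a
  for every invariant \<mu>. The distribution functions then satisfy F(x) = a F'(x / a) for x < a and
  F(x) = a + F(x - a) for x \<ge> a, where x - a < a. So a bound valid for the deviation of F(x) from x
  for all invariant \<mu> improves by the factor a; hence F(x) = x.
  Conversely, Lebesgue measure is invariant because T rearranges countably many intervals.
\<close>

abbreviation unit_borel :: "real measure" where
  "unit_borel \<equiv> restrict_space borel {0..<1}"

abbreviation T :: "real \<Rightarrow> real" where
  "T \<equiv> kakutani_fibonacci"

section \<open>Endpoints, lengths and images of the exchanged intervals\<close>

lemma kf_left_add_2: "kf_left (n + 2) = kf_left n + \<alpha> ^ (n + 1)"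
proof (cases "even n")
  case True
  then obtain k where "n = 2 * k" by (auto elim: evenE)
  then show ?thesis by (simp add: kf_left_def)
next
  case False
  then obtain k where "n = 2 * k + 1" by (auto elim: oddE)
  then show ?thesis by (simp add: kf_left_def)
qed

text \<open>By the closed forms, scaling by \<alpha> moves each left endpoint to the next one, up to
  a shift for odd n that comes from \<alpha>^2 = 1 - \<alpha>. This is the source of the
  self-similarity.\<close>

lemma kf_left_scale:
  "\<alpha> * kf_left n = kf_left (n + 1) - (if odd n then \<alpha> else 0)"
proof (cases "even n")
  case True
  then obtain k where "n = 2 * k" by (auto elim: evenE)
  then have "kf_left n = 1 - \<alpha> ^ n" "kf_left (n + 1) = \<alpha> - \<alpha> ^ (n + 1)"
    by (simp_all only: kf_left_even kf_left_odd)
  then show ?thesis using True by (simp add: right_diff_distrib)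
next
  case False
  then obtain k where "n = 2 * k + 1" by (auto elim: oddE)
  then have "kf_left n = \<alpha> - \<alpha> ^ n" "kf_left (n + 1) = 1 - \<alpha> ^ (n + 1)"
    using kf_left_odd[of k] kf_left_even[of "k + 1"] by simp_all
  then show ?thesis using False golden_square by (simp add: right_diff_distrib)
qed

lemma kf_interval_obtain:
  assumes "0 \<le> x" "x < 1"
  obtains n where "1 \<le> n" "x \<in> kf_interval n"
  using assms kf_interval_partition(1) by (metis UN_E atLeastLessThan_iff atLeast_iff)

lemma golden_power_diff:
  assumes "1 \<le> n"
  shows "\<alpha> ^ n + \<alpha> ^ (n + 1) = \<alpha> ^ (n - 1)"
proof -
  obtain m where m: "n = Suc m" using assms by (cases n) auto
  have "\<alpha> ^ n + \<alpha> ^ (n + 1) = \<alpha> ^ m * (\<alpha> + \<alpha> * \<alpha>)" by (simp add: m algebra_simps)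
  then show ?thesis unfolding golden_square by (simp add: m)
qed

text \<open>The left endpoint is sent to \<alpha>^n, and the length \<alpha>^(n+1) of the interval
  equals \<alpha>^(n-1) - \<alpha>^n.\<close>

lemma kakutani_fibonacci_image:
  assumes "1 \<le> n" "x \<in> kf_interval n"
  shows "T x \<in> {\<alpha> ^ n ..< \<alpha> ^ (n - 1)}"
  using assms(2) kf_left_add_2[of n] golden_power_diff[OF assms(1)]
  by (simp add: kakutani_fibonacci_eq[OF assms] kf_interval_def)

lemma kakutani_fibonacci_range:
  assumes "0 \<le> x" "x < 1"
  shows "0 \<le> T x" "T x < 1"
proof -
  obtain n where n: "1 \<le> n" "x \<in> kf_interval n" using kf_interval_obtain[OF assms] .
  have "0 < \<alpha> ^ n" using golden_pos by simp
  then show "0 \<le> T x" "T x < 1"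
    using kakutani_fibonacci_image[OF n] golden_power_mono[of 0 "n - 1"] by auto
qed

lemma kakutani_fibonacci_ge_iff:
  assumes "0 \<le> x" "x < 1"
  shows "\<alpha> \<le> T x \<longleftrightarrow> x < \<alpha> ^ 2"
proof
  assume "x < \<alpha> ^ 2"
  then show "\<alpha> \<le> T x" using assms kakutani_fibonacci_1[of x] by simp
next
  assume T: "\<alpha> \<le> T x"
  obtain n where n: "1 \<le> n" "x \<in> kf_interval n" using kf_interval_obtain[OF assms] .
  have "n = 1"
  proof (rule ccontr)
    assume "n \<noteq> 1"
    then have "1 \<le> n - 1" using n by simp
    then have "T x < \<alpha>"
      using kakutani_fibonacci_image[OF n] golden_power_mono[of 1 "n - 1"] by simp
    with T show False by simp
  qed
  then show "x < \<alpha> ^ 2" using n by (simp add: kf_interval_def kf_left_def)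
qed

section \<open>Self-similarity of the map\<close>

lemma kf_interval_odd_iff:
  assumes "1 \<le> n" "x \<in> kf_interval n"
  shows "odd n \<longleftrightarrow> x < \<alpha>"
proof (cases "even n")
  case True
  then obtain k where k: "n = 2 * k" by (auto elim: evenE)
  have "\<alpha> ^ (2 * k) \<le> \<alpha> ^ 2" using assms k by (intro golden_power_mono) auto
  then show ?thesis using assms k golden_square by (simp add: kf_interval_even power2_eq_square)
next
  case False
  then obtain k where k: "n = 2 * k + 1" by (auto elim: oddE)
  have "x < \<alpha> - \<alpha> ^ (2 * (k + 1) + 1)" using assms(2) unfolding k kf_interval_odd by simp
  moreover have "0 < \<alpha> ^ (2 * (k + 1) + 1)" using golden_pos by simp
  ultimately show ?thesis using False by linarith
qed

lemma kakutani_fibonacci_renormalize: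
  assumes "0 \<le> x" "x < 1"
  shows "\<alpha> * T x = (if x < \<alpha> then T (T (\<alpha> * x)) else T (\<alpha> * x))"
proof -
  obtain n where n: "1 \<le> n" "x \<in> kf_interval n" using kf_interval_obtain[OF assms] .
  \<comment> \<open>T x is \<alpha>^n plus the offset of x from the left endpoint of its interval.
    The offset of y in the next interval is \<alpha> times that of x, so T y = \<alpha> * T x. For
    odd n the added \<alpha> is one application of T to \<alpha> * x.\<close>
  define y where "y = \<alpha> * x + (if odd n then \<alpha> else 0)"
  have "\<alpha> * kf_left n \<le> \<alpha> * x" "\<alpha> * x < \<alpha> * kf_left (n + 2)"
    using n golden_pos by (auto simp: kf_interval_def)
  then have "y \<in> kf_interval (n + 1)"
    unfolding kf_left_scale y_def kf_interval_def
    by (auto simp: algebra_simps split: if_splits)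
  then have "T y = y + \<alpha> ^ (n + 1) - kf_left (n + 1)"
    by (intro kakutani_fibonacci_eq) auto
  also have "\<dots> = \<alpha> * T x"
    using kf_left_scale[of n]
    by (simp add: kakutani_fibonacci_eq[OF n] y_def algebra_simps)
  finally have "\<alpha> * T x = T y" ..
  moreover have "T (\<alpha> * x) = y" if "x < \<alpha>"
    using that assms golden_pos kf_interval_odd_iff[OF n]
    by (subst kakutani_fibonacci_1) (auto simp: y_def power2_eq_square)
  ultimately show ?thesis
    using kf_interval_odd_iff[OF n] by (simp add: y_def)
qed

section \<open>Measurability of the map and invariance of Lebesgue measure\<close>

lemma sets_unit_borel: "A \<in> sets unit_borel \<longleftrightarrow> A \<in> sets borel \<and> A \<subseteq> {0..<1}"
  by (auto simp: sets_restrict_space_iff)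

lemma kakutani_fibonacci_vimage:
  "T -` A \<inter> {0..<1} =
     (\<Union>n. kf_interval (Suc n) \<inter> (\<lambda>x. x + (\<alpha> ^ Suc n - kf_left (Suc n))) -` A)"
proof -
  have "{0..<1} = (\<Union>n. kf_interval (Suc n))"
    unfolding kf_interval_partition(1)[symmetric]
    by (auto simp: Suc_le_eq gr0_conv_Suc)
  moreover have "T x = x + (\<alpha> ^ Suc n - kf_left (Suc n))" if "x \<in> kf_interval (Suc n)" for n x
    using kakutani_fibonacci_eq[OF _ that] by simp
  ultimately show ?thesis by fastforce
qed

lemma measurable_kakutani_fibonacci: "T \<in> unit_borel \<rightarrow>\<^sub>M unit_borel"
proof (rule measurableI)
  fix A assume "A \<in> sets unit_borel"
  then have [measurable]: "A \<in> sets borel" by (simp add: sets_unit_borel)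
  have "T -` A \<inter> {0..<1} \<in> sets borel"
    unfolding kakutani_fibonacci_vimage kf_interval_def
    using measurable_sets[of "\<lambda>x::real. x + c" borel borel A for c] by auto
  then show "T -` A \<inter> space unit_borel \<in> sets unit_borel" by (simp add: sets_unit_borel)
qed (use kakutani_fibonacci_range in auto)

text \<open>The intervals on the right are the images of the exchanged intervals, so the map misses
  only 0.\<close>

lemma greaterThanLessThan_golden:
  "{0<..<1} = (\<Union>n. {\<alpha> ^ Suc n ..< \<alpha> ^ n})"
proof (intro equalityI subsetI)
  fix x :: real assume x: "x \<in> {0<..<1}"
  then obtain N where "\<alpha> ^ N < x" using real_arch_pow_inv[of x \<alpha>] golden_less_1 by auto
  then have ex: "\<alpha> ^ N \<le> x" by simp
  define n where "n = (LEAST n. \<alpha> ^ n \<le> x)"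
  have n: "\<alpha> ^ n \<le> x" unfolding n_def using ex by (rule LeastI)
  then have "n \<noteq> 0" using x by (intro notI) auto
  then obtain m where m: "n = Suc m" by (cases n) auto
  then have "\<not> \<alpha> ^ m \<le> x" using not_less_Least[of m "\<lambda>n. \<alpha> ^ n \<le> x"] unfolding n_def by simp
  then show "x \<in> (\<Union>n. {\<alpha> ^ Suc n ..< \<alpha> ^ n})" using n m by auto
next
  fix x assume "x \<in> (\<Union>n. {\<alpha> ^ Suc n ..< \<alpha> ^ n})"
  then obtain n where "\<alpha> ^ Suc n \<le> x" "x < \<alpha> ^ n" by auto
  moreover have "0 < \<alpha> ^ Suc n" using golden_pos by simp
  ultimately show "x \<in> {0<..<1}" using golden_power_mono[of 0 n] by auto
qed

lemma invariant_prob_lebesgue: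
  "invariant_prob unit_borel T (restrict_space lborel {0..<1})"
  unfolding invariant_prob_def
proof (intro conjI ballI)
  show "sets (restrict_space lborel {0..<1}) = sets unit_borel"
    by (simp cong: sets_restrict_space_cong)
  show "prob_space (restrict_space lborel {0..<1::real})"
    by (intro prob_spaceI) (simp add: emeasure_restrict_space space_restrict_space)
  fix A assume A: "A \<in> sets unit_borel"
  then have [measurable]: "A \<in> sets borel" and sub: "A \<subseteq> {0..<1}" by (simp_all add: sets_unit_borel)
  \<comment> \<open>\<open>I n\<close> is the part of the preimage of A in the interval of index n +
    1, and \<open>J n\<close> is the part of A in the image of that interval. They are translates of
    each other.\<close>
  define I where "I n = kf_interval (Suc n) \<inter> (\<lambda>x. x + (\<alpha> ^ Suc n - kf_left (Suc n))) -` A" for n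
  define J where "J n = {\<alpha> ^ Suc n ..< \<alpha> ^ n} \<inter> A" for n
  have meas: "I n \<in> sets borel" "J n \<in> sets borel" for n
    unfolding I_def J_def kf_interval_def
    using measurable_sets[of "\<lambda>x::real. x + c" borel borel A for c] by auto
  have IJ: "I n = (+) (\<alpha> ^ Suc n - kf_left (Suc n)) -` J n \<inter> space lborel" for n
    unfolding I_def J_def kf_interval_def
    using kf_left_add_2[of "Suc n"] golden_power_diff[of "Suc n"]
    by (auto simp: add.commute)
  have eq: "emeasure lborel (I n) = emeasure lborel (J n)" for n
  proof -
    have "emeasure lborel (J n) = emeasure (distr lborel borel ((+) (\<alpha> ^ Suc n - kf_left (Suc n)))) (J n)"
      by (simp add: lborel_distr_plus)
    also have "\<dots> = emeasure lborel (I n)"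
      using meas by (subst emeasure_distr) (auto simp: IJ)
    finally show ?thesis ..
  qed
  have "disjoint_family I"
    by (auto simp: disjoint_family_on_def I_def dest: kf_interval_unique[rotated 2])
  moreover have "disjoint_family J"
    unfolding disjoint_family_on_def
  proof (intro ballI impI)
    fix m n :: nat assume "m \<noteq> n"
    then consider "Suc m \<le> n" | "Suc n \<le> m" by linarith
    then have "\<alpha> ^ n \<le> \<alpha> ^ Suc m \<or> \<alpha> ^ m \<le> \<alpha> ^ Suc n"
      by cases (auto simp del: power_Suc dest: golden_power_mono)
    then show "J m \<inter> J n = {}" by (auto simp: J_def simp del: power_Suc)
  qed
  ultimately have "emeasure lborel (\<Union>n. I n) = emeasure lborel (\<Union>n. J n)"
    using meas by (simp add: suminf_emeasure[symmetric] image_subset_iff eq)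
  moreover have "(\<Union>n. J n) = {0<..<1} \<inter> A"
    unfolding J_def greaterThanLessThan_golden by blast
  \<comment> \<open>The point 0 is lost because it has no preimage, but it is a null set.\<close>
  moreover have "{0<..<1} \<inter> A = A - {0}" using sub by force
  moreover have "emeasure lborel (A - {0}) = emeasure lborel A"
    by (intro emeasure_Diff_null_set) auto
  ultimately have "emeasure lborel (T -` A \<inter> {0..<1}) = emeasure lborel A"
    unfolding kakutani_fibonacci_vimage I_def by metis
  then show "emeasure (restrict_space lborel {0..<1}) (T -` A \<inter> space unit_borel)
      = emeasure (restrict_space lborel {0..<1}) A"
    using sub by (simp add: emeasure_restrict_space)
qed

section \<open>Invariant probabilities and their renormalization\<close>

text \<open>Conditioning on {0..<\<alpha>}, followed by stretching onto {0..<1}. The default 0 only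
  keeps the values in {0..<1}: the conditional measure has no mass where it applies.\<close>

definition renormalize :: "real measure \<Rightarrow> real measure" where
  "renormalize \<mu> = distr (uniform_measure \<mu> {0..<\<alpha>}) unit_borel (\<lambda>y. if y < \<alpha> then y / \<alpha> else 0)"

locale kf_invariant = prob_space \<mu> for \<mu> :: "real measure" +
  assumes sets_eq: "sets \<mu> = sets unit_borel"
    and invariant: "A \<in> sets unit_borel \<Longrightarrow> prob (T -` A \<inter> {0..<1}) = prob A"

lemma invariant_prob_iff: "invariant_prob unit_borel T \<mu> \<longleftrightarrow> kf_invariant \<mu>"
  unfolding invariant_prob_def kf_invariant_def kf_invariant_axioms_def
  by (auto simp: finite_measure.emeasure_eq_measure prob_space.finite_measure)

context kf_invariant
begin

lemma space_eq: "space \<mu> = {0..<1}"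
  using sets_eq_imp_space_eq[OF sets_eq] by simp

lemma sets_iff: "A \<in> sets \<mu> \<longleftrightarrow> A \<in> sets borel \<and> A \<subseteq> {0..<1}"
  by (simp add: sets_eq sets_unit_borel)

lemma vimage_sets: "A \<in> sets \<mu> \<Longrightarrow> T -` A \<inter> {0..<1} \<in> sets \<mu>"
  using measurable_sets[OF measurable_kakutani_fibonacci, of A] by (simp add: sets_eq)

text \<open>The preimage under T of the translated set is A itself: T adds \<alpha> on the first
  interval, and no other point has its image at or above \<alpha>.\<close>

lemma prob_translate:
  assumes "A \<in> sets borel" "A \<subseteq> {0..<\<alpha> ^ 2}"
  shows "prob ((\<lambda>x. x - \<alpha>) -` A) = prob A"
proof -
  have a2: "\<alpha> ^ 2 = 1 - \<alpha>" using golden_square by (simp add: power2_eq_square)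
  have "(\<lambda>x. x - \<alpha>) -` A \<in> sets borel"
    using measurable_sets[of "\<lambda>x::real. x - \<alpha>" borel borel A] assms by simp
  then have *: "(\<lambda>x. x - \<alpha>) -` A \<in> sets unit_borel"
    using assms golden_pos a2 by (force simp: sets_unit_borel)
  have "T -` (\<lambda>x. x - \<alpha>) -` A \<inter> {0..<1} = A"
  proof (intro equalityI subsetI)
    fix x assume x: "x \<in> A"
    then have "x \<in> {0..<\<alpha> ^ 2}" using assms by auto
    then show "x \<in> T -` (\<lambda>x. x - \<alpha>) -` A \<inter> {0..<1}"
      using x a2 golden_pos kakutani_fibonacci_1[of x] by auto
  next
    fix x assume x: "x \<in> T -` (\<lambda>x. x - \<alpha>) -` A \<inter> {0..<1}"
    then have "\<alpha> \<le> T x" using assms by force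
    then have "x \<in> {0..<\<alpha> ^ 2}" using x kakutani_fibonacci_ge_iff[of x] by auto
    then show "x \<in> A" using x kakutani_fibonacci_1[of x] by auto
  qed
  then show ?thesis using invariant[OF *] by simp
qed

lemma prob_golden_sum: "prob {0..<\<alpha>} + prob {0..<\<alpha> ^ 2} = 1"
proof -
  have a2: "\<alpha> ^ 2 = 1 - \<alpha>" using golden_square by (simp add: power2_eq_square)
  have "(\<lambda>x. x - \<alpha>) -` {0..<\<alpha> ^ 2} = {\<alpha>..<1}" using a2 by auto
  then have "prob {0..<\<alpha> ^ 2} = prob {\<alpha>..<1}"
    using prob_translate[of "{0..<\<alpha> ^ 2}"] by simp
  also have "prob {0..<\<alpha>} + \<dots> = prob ({0..<\<alpha>} \<union> {\<alpha>..<1})"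
    using golden_pos golden_less_1 by (intro finite_measure_Union[symmetric]) (auto simp: sets_iff)
  also have "{0..<\<alpha>} \<union> {\<alpha>..<1} = space \<mu>"
    using golden_pos golden_less_1 by (auto simp: space_eq)
  finally show ?thesis by (simp add: prob_space)
qed

text \<open>Makes the conditioning legitimate. If this interval were null, so would be its subset
  {0..<\<alpha>^2}, although the two masses sum to 1.\<close>

lemma prob_golden_pos: "0 < prob {0..<\<alpha>}"
proof (rule ccontr)
  assume "\<not> 0 < prob {0..<\<alpha>}"
  moreover have "prob {0..<\<alpha> ^ 2} \<le> prob {0..<\<alpha>}"
    using golden_power_mono[of 1 2] golden_less_1 by (intro finite_measure_mono) (auto simp: sets_iff)
  ultimately show False using prob_golden_sum by simp
qed

lemma sets_renormalize: "sets (renormalize \<mu>) = sets unit_borel"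
  by (simp add: renormalize_def)

lemma measurable_rescale: "(\<lambda>y. if y < \<alpha> then y / \<alpha> else 0) \<in> \<mu> \<rightarrow>\<^sub>M unit_borel"
proof -
  have "(\<lambda>y. if y < \<alpha> then y / \<alpha> else 0) \<in> unit_borel \<rightarrow>\<^sub>M unit_borel"
    using golden_pos
    by (intro measurable_restrict_space3 measurable_If) (auto simp: field_simps)
  then show ?thesis by (simp cong: measurable_cong_sets add: measurable_cong_sets[OF sets_eq refl])
qed

lemma prob_space_renormalize: "prob_space (renormalize \<mu>)"
  unfolding renormalize_def
proof (rule prob_space.prob_space_distr)
  show "prob_space (uniform_measure \<mu> {0..<\<alpha>})"
    using prob_golden_pos by (intro prob_space_uniform_measure) (auto simp: emeasure_eq_measure)
  show "(\<lambda>y. if y < \<alpha> then y / \<alpha> else 0) \<in> uniform_measure \<mu> {0..<\<alpha>} \<rightarrow>\<^sub>M unit_borel"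
    using measurable_rescale by simp
qed

lemma measure_renormalize:
  assumes "A \<in> sets unit_borel"
  shows "measure (renormalize \<mu>) A = prob ((\<lambda>y. y / \<alpha>) -` A) / prob {0..<\<alpha>}"
proof -
  let ?g = "\<lambda>y. if y < \<alpha> then y / \<alpha> else 0"
  have g: "?g \<in> uniform_measure \<mu> {0..<\<alpha>} \<rightarrow>\<^sub>M unit_borel" using measurable_rescale by simp
  have "measure (renormalize \<mu>) A = measure (uniform_measure \<mu> {0..<\<alpha>}) (?g -` A \<inter> space \<mu>)"
    unfolding renormalize_def using assms g by (subst measure_distr) auto
  also have "\<dots> = prob ({0..<\<alpha>} \<inter> (?g -` A \<inter> space \<mu>)) / prob {0..<\<alpha>}"
    using measurable_sets[OF measurable_rescale assms] prob_golden_pos golden_less_1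
    by (intro measure_uniform_measure) (auto simp: emeasure_eq_measure sets_iff)
  \<comment> \<open>As A lies in {0..<1}, y / \<alpha> \<in> A already forces y into {0..<\<alpha>},
    so neither the default value nor the conditioning set remains.\<close>
  also have "{0..<\<alpha>} \<inter> (?g -` A \<inter> space \<mu>) = (\<lambda>y. y / \<alpha>) -` A"
    using assms golden_pos golden_less_1
    by (force simp: space_eq sets_unit_borel field_simps)
  finally show ?thesis .
qed

text \<open>By the renormalization identity, rescaling conjugates the map to its
  first return map on the interval from 0 to the golden number.\<close>

lemma kf_invariant_renormalize: "kf_invariant (renormalize \<mu>)"
proof (intro kf_invariant.intro kf_invariant_axioms.intro prob_space_renormalize sets_renormalize)
  fix A assume A: "A \<in> sets unit_borel"
  have TA: "T -` A \<inter> {0..<1} \<in> sets unit_borel" using vimage_sets[of A] A by (simp add: sets_eq)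
  \<comment> \<open>B is the copy of A in {0..<\<alpha>}; C consists of the points outside
    {0..<\<alpha>} that T sends into B.\<close>
  define B where "B = (\<lambda>y. y / \<alpha>) -` A"
  define C where "C = T -` B \<inter> {\<alpha>..<1}"
  have nonneg: "0 \<le> x" if "\<alpha> ^ 2 \<le> x" for x
    using that zero_le_power2[of \<alpha>] by linarith
  have a2: "\<alpha> ^ 2 < \<alpha>" using golden_pos golden_less_1 by (simp add: power2_eq_square)
  have Bsub: "B \<subseteq> {0..<\<alpha>}"
    using A golden_pos by (force simp: B_def sets_unit_borel field_simps)
  have "B \<in> sets borel"
    using measurable_sets[of "\<lambda>y. y / \<alpha>" borel borel A] A by (simp add: B_def sets_unit_borel)
  then have B: "B \<in> sets \<mu>" using Bsub golden_less_1 by (force simp: sets_iff)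
  have C: "C \<in> sets \<mu>"
  proof -
    have "C = (T -` B \<inter> {0..<1}) \<inter> {\<alpha>..<1}" using golden_pos by (auto simp: C_def)
    moreover have "{\<alpha>..<1} \<in> sets \<mu>" using golden_pos by (auto simp: sets_iff)
    ultimately show ?thesis using vimage_sets[OF B] by auto
  qed
  \<comment> \<open>Points of C are at least \<alpha>, so only the first interval reaches them;
    points of B are below \<alpha>, so the first interval never does.\<close>
  have lo: "T -` C \<inter> {0..<1} = T -` C \<inter> {0..<\<alpha> ^ 2}"
    using kakutani_fibonacci_ge_iff a2 golden_less_1 by (auto simp: C_def)
  have hi: "T -` B \<inter> {0..<1} = (T -` B \<inter> {\<alpha> ^ 2..<\<alpha>}) \<union> C"
  proof -
    have "\<alpha> ^ 2 \<le> x" if "x \<in> T -` B \<inter> {0..<1}" for x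
      using that Bsub kakutani_fibonacci_ge_iff[of x] by force
    moreover have "0 < \<alpha> ^ 2" using golden_pos by simp
    ultimately show ?thesis using golden_pos golden_less_1 a2 unfolding C_def
      by (auto simp: not_le intro: nonneg)
  qed
  have mid: "T -` B \<inter> {\<alpha> ^ 2..<\<alpha>} \<in> sets \<mu>"
  proof -
    have "T -` B \<inter> {\<alpha> ^ 2..<\<alpha>} = (T -` B \<inter> {0..<1}) \<inter> {\<alpha> ^ 2..<\<alpha>}"
      using golden_less_1 by (auto intro: nonneg)
    moreover have "{\<alpha> ^ 2..<\<alpha>} \<in> sets \<mu>"
      using golden_less_1 by (auto simp: sets_iff intro: nonneg)
    ultimately show ?thesis using vimage_sets[OF B] by auto
  qed
  \<comment> \<open>Invariance is used twice. Points of {\<alpha>^2..<\<alpha>} enter B after one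
    step; the mass of C is pulled back once more, to points of {0..<\<alpha>^2} that enter B after
    two steps.\<close>
  have "prob B = prob (T -` B \<inter> {\<alpha> ^ 2..<\<alpha>}) + prob C"
    unfolding invariant[OF B[unfolded sets_eq], symmetric] hi
    using mid C by (intro finite_measure_Union) (auto simp: C_def)
  also have "prob C = prob (T -` C \<inter> {0..<\<alpha> ^ 2})"
    using invariant[of C] C by (simp add: sets_eq lo)
  also have "prob (T -` B \<inter> {\<alpha> ^ 2..<\<alpha>}) + \<dots>
      = prob ((T -` B \<inter> {\<alpha> ^ 2..<\<alpha>}) \<union> (T -` C \<inter> {0..<\<alpha> ^ 2}))"
    using mid vimage_sets[OF C] by (intro finite_measure_Union[symmetric]) (auto simp: lo)
  \<comment> \<open>The union is the preimage of B under the first return map, which the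
    renormalization identity turns into the copy of the preimage of A.\<close>
  also have "(T -` B \<inter> {\<alpha> ^ 2..<\<alpha>}) \<union> (T -` C \<inter> {0..<\<alpha> ^ 2})
      = (\<lambda>y. y / \<alpha>) -` (T -` A \<inter> {0..<1})"
  proof (rule set_eqI)
    fix y
    show "y \<in> (T -` B \<inter> {\<alpha> ^ 2..<\<alpha>}) \<union> (T -` C \<inter> {0..<\<alpha> ^ 2}) \<longleftrightarrow>
        y \<in> (\<lambda>y. y / \<alpha>) -` (T -` A \<inter> {0..<1})"
    proof (cases "0 \<le> y \<and> y < \<alpha>")
      case False
      then show ?thesis using golden_pos a2
        by (auto simp: field_simps intro: nonneg)
    next
      case True
      define x where "x = y / \<alpha>"
      have x: "y = \<alpha> * x" "0 \<le> x" "x < 1" using True golden_pos by (auto simp: x_def)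
      have TA: "T x \<in> A \<longleftrightarrow> \<alpha> * T x \<in> B" using golden_pos by (simp add: B_def)
      have xa: "x < \<alpha> \<longleftrightarrow> y < \<alpha> ^ 2" using golden_pos by (simp add: x(1) power2_eq_square)
      have T1: "\<alpha> \<le> T y" "T y < 1" if "y < \<alpha> ^ 2"
        using that True kakutani_fibonacci_ge_iff[of y] kakutani_fibonacci_range[of y] golden_less_1
        by auto
      have "x \<in> T -` A \<inter> {0..<1} \<longleftrightarrow> (if x < \<alpha> then T (T y) \<in> B else T y \<in> B)"
        using x TA kakutani_fibonacci_renormalize[of x] by simp
      then show ?thesis using True T1 xa by (auto simp: C_def x_def)
    qed
  qed
  finally show "measure (renormalize \<mu>) (T -` A \<inter> {0..<1}) = measure (renormalize \<mu>) A"
    using A TA by (simp add: measure_renormalize B_def)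
qed

end

section \<open>Masses of initial intervals under an invariant probability\<close>

text \<open>The recursion p = 1 / (1 + p') between the masses of the interval from 0 to the golden
  number before and after renormalization is a contraction with the golden number as fixed point.\<close>

lemma prob_golden_approx:
  assumes "kf_invariant \<mu>"
  shows "\<bar>measure \<mu> {0..<\<alpha>} - \<alpha>\<bar> \<le> \<alpha> ^ n"
  using assms
\<comment> \<open>The measure stays arbitrary because the induction hypothesis is applied to its
  renormalization.\<close>
proof (induction n arbitrary: \<mu>)
  case 0
  interpret kf_invariant \<mu> by fact
  have "0 \<le> prob {0..<\<alpha>}" "prob {0..<\<alpha>} \<le> 1" by simp_all
  then show ?case using golden_pos golden_less_1 unfolding power_0 abs_le_iff by linarith
next
  case (Suc n)
  interpret kf_invariant \<mu> by fact
  define p where "p = prob {0..<\<alpha>}"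
  define q where "q = measure (renormalize \<mu>) {0..<\<alpha>}"
  have IH: "\<bar>q - \<alpha>\<bar> \<le> \<alpha> ^ n" unfolding q_def using Suc.IH kf_invariant_renormalize .
  have "{0..<\<alpha>} \<in> sets unit_borel" using golden_less_1 by (auto simp: sets_unit_borel)
  moreover have "(\<lambda>y. y / \<alpha>) -` {0..<\<alpha>} = {0..<\<alpha> ^ 2}"
    using golden_pos by (auto simp: field_simps power2_eq_square)
  ultimately have "p * q = prob {0..<\<alpha> ^ 2}"
    using prob_golden_pos measure_renormalize[of "{0..<\<alpha>}"] by (simp add: p_def q_def)
  then have "p + p * q = 1" using prob_golden_sum by (simp add: p_def)
  \<comment> \<open>The difference of p * \<alpha> * (1 + \<alpha>) = p and p * \<alpha> * (1 + q) =
    \<alpha>. As p \<le> 1, the deviation shrinks by the factor \<alpha>.\<close>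
  then have "p - \<alpha> = p * \<alpha> * (\<alpha> - q)" using golden_square by algebra
  then have "\<bar>p - \<alpha>\<bar> = p * (\<alpha> * \<bar>q - \<alpha>\<bar>)"
    using prob_golden_pos golden_pos by (simp add: abs_mult p_def abs_minus_commute)
  also have "\<dots> \<le> 1 * (\<alpha> * \<alpha> ^ n)"
    using IH golden_pos by (intro mult_mono mult_left_mono) (auto simp: p_def)
  finally show ?case by (simp add: p_def)
qed

lemma eq_if_golden_approx:
  assumes "\<And>n. \<bar>x - y\<bar> \<le> \<alpha> ^ n"
  shows "x = y"
proof (rule ccontr)
  assume "x \<noteq> y"
  then obtain n where "\<alpha> ^ n < \<bar>x - y\<bar>"
    using real_arch_pow_inv[of "\<bar>x - y\<bar>" \<alpha>] golden_less_1 by auto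
  with assms[of n] show False by simp
qed

lemma prob_golden:
  assumes "kf_invariant \<mu>"
  shows "measure \<mu> {0..<\<alpha>} = \<alpha>"
  using prob_golden_approx[OF assms] by (rule eq_if_golden_approx)

lemma prob_atLeastAtMost_approx:
  assumes "kf_invariant \<mu>" "0 \<le> x" "x < 1"
  shows "\<bar>measure \<mu> {0..x} - x\<bar> \<le> \<alpha> ^ n"
  using assms
proof (induction n arbitrary: \<mu> x)
  case 0
  interpret kf_invariant \<mu> by fact
  have "0 \<le> prob {0..x}" "prob {0..x} \<le> 1" by simp_all
  then show ?case using 0 unfolding power_0 abs_le_iff by linarith
next
  case (Suc n)
  interpret kf_invariant \<mu> by fact
  \<comment> \<open>Since {0..<\<alpha>} has mass exactly \<alpha>, mass and length are rescaled by
    the same factor, so the deviation at y is \<alpha> times that of the renormalized measure at y /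
    \<alpha>.\<close>
  have low: "\<bar>prob {0..y} - y\<bar> \<le> \<alpha> ^ Suc n" if y: "0 \<le> y" "y < \<alpha>" for y
  proof -
    have y': "0 \<le> y / \<alpha>" "y / \<alpha> < 1" using y golden_pos by auto
    have "(\<lambda>z. z / \<alpha>) -` {0..y / \<alpha>} = {0..y}"
      using golden_pos by (auto simp: field_simps)
    then have "measure (renormalize \<mu>) {0..y / \<alpha>} = prob {0..y} / \<alpha>"
      using measure_renormalize[of "{0..y / \<alpha>}"] y' prob_golden[OF Suc.prems(1)]
      by (auto simp: sets_unit_borel subset_iff)
    then have "prob {0..y} - y = \<alpha> * (measure (renormalize \<mu>) {0..y / \<alpha>} - y / \<alpha>)"
      using golden_pos by (simp add: field_simps)
    then have "\<bar>prob {0..y} - y\<bar> = \<alpha> * \<bar>measure (renormalize \<mu>) {0..y / \<alpha>} - y / \<alpha>\<bar>"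
      using golden_pos by (simp add: abs_mult)
    also have "\<dots> \<le> \<alpha> * \<alpha> ^ n"
      using Suc.IH[OF kf_invariant_renormalize y'] golden_pos by (intro mult_left_mono) auto
    finally show ?thesis by simp
  qed
  show ?case
  proof (cases "x < \<alpha>")
    case True
    then show ?thesis using low Suc.prems by simp
  next
    case False
    have a2: "\<alpha> ^ 2 = 1 - \<alpha>" using golden_square by (simp add: power2_eq_square)
    have "(\<lambda>y. y - \<alpha>) -` {0..x - \<alpha>} = {\<alpha>..x}" by auto
    then have "prob {0..x - \<alpha>} = prob {\<alpha>..x}"
      using prob_translate[of "{0..x - \<alpha>}"] Suc.prems a2 by (auto simp: subset_iff)
    moreover have "prob {0..x} = prob ({0..<\<alpha>} \<union> {\<alpha>..x})"
      using False golden_pos by (intro arg_cong[where f = prob]) auto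
    moreover have "\<dots> = prob {0..<\<alpha>} + prob {\<alpha>..x}"
      using False golden_pos Suc.prems by (intro finite_measure_Union) (auto simp: sets_iff)
    \<comment> \<open>Mass and position both drop by \<alpha>, so the deviation is unchanged, and a
      single translation already leads below \<alpha>.\<close>
    ultimately have "prob {0..x} - x = prob {0..x - \<alpha>} - (x - \<alpha>)"
      using prob_golden[OF Suc.prems(1)] by simp
    moreover have "x - \<alpha> < \<alpha>"
      using Suc.prems a2 golden_power_mono[of 1 2] by simp
    ultimately show ?thesis using low[of "x - \<alpha>"] False by simp
  qed
qed

lemma prob_atLeastAtMost:
  assumes "kf_invariant \<mu>" "0 \<le> x" "x < 1"
  shows "measure \<mu> {0..x} = x"
  using prob_atLeastAtMost_approx[OF assms] by (rule eq_if_golden_approx)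

section \<open>Uniqueness through distribution functions\<close>

text \<open>The identity serves as the inclusion of {0..<1} into the line, since
  \<open>cdf_unique\<close> compares distributions on the whole line.\<close>

lemma (in kf_invariant) measurable_id_borel: "(\<lambda>x. x) \<in> \<mu> \<rightarrow>\<^sub>M borel"
  by (auto simp: measurable_def space_eq sets_iff)

lemma (in kf_invariant) cdf_distr:
  "cdf (distr \<mu> borel (\<lambda>x. x)) x = (if x < 0 then 0 else if x < 1 then x else 1)"
proof -
  have "cdf (distr \<mu> borel (\<lambda>x. x)) x = prob ({..x} \<inter> {0..<1})"
    unfolding cdf_def using measurable_id_borel by (subst measure_distr) (auto simp: space_eq)
  moreover have "{..x} \<inter> {0..<1} = (if x < 0 then {} else if x < 1 then {0..x} else space \<mu>)"
    by (auto simp: space_eq)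
  ultimately show ?thesis
    using prob_atLeastAtMost[OF kf_invariant_axioms, of x] by (simp add: prob_space)
qed

lemma kf_invariant_unique:
  assumes "kf_invariant \<mu>" "kf_invariant \<nu>"
  shows "\<mu> = \<nu>"
proof -
  interpret \<mu>: kf_invariant \<mu> by fact
  interpret \<nu>: kf_invariant \<nu> by fact
  have "real_distribution (distr \<mu> borel (\<lambda>x. x))" "real_distribution (distr \<nu> borel (\<lambda>x. x))"
    using \<mu>.real_distribution_distr[OF \<mu>.measurable_id_borel]
      \<nu>.real_distribution_distr[OF \<nu>.measurable_id_borel] by auto
  then have eq: "distr \<mu> borel (\<lambda>x. x) = distr \<nu> borel (\<lambda>x. x)"
    by (rule cdf_unique) (auto simp: \<mu>.cdf_distr \<nu>.cdf_distr)
  show ?thesis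
  proof (rule measure_eqI)
    show "sets \<mu> = sets \<nu>" by (simp add: \<mu>.sets_eq \<nu>.sets_eq)
    fix A assume "A \<in> sets \<mu>"
    \<comment> \<open>Lying in {0..<1}, the set A is its own preimage under the inclusion, so the
      distributions on the line determine its mass.\<close>
    then have A: "A \<in> sets borel" "A \<inter> {0..<1} = A" by (auto simp: \<mu>.sets_iff)
    show "emeasure \<mu> A = emeasure \<nu> A"
      using arg_cong[OF eq, of "\<lambda>M. emeasure M A"] A
      by (simp add: emeasure_distr \<mu>.measurable_id_borel \<nu>.measurable_id_borel
          \<mu>.space_eq \<nu>.space_eq)
  qed
qed

theorem theorem4p1p7:
  shows "uniquely_ergodic (restrict_space borel {0..<1::real}) kakutani_fibonacci"
  unfolding uniquely_ergodic_def
  using measurable_kakutani_fibonacci invariant_prob_lebesgue kf_invariant_unique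
  by (auto simp: invariant_prob_iff)

end
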